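(* $\mathrm{SAT}(\aleph_0)$ implies $2^{<\mathfrak{c}}=\mathfrak{c}$.
   Context: All ultrafilters are nonprincipal. For a cardinal $\kappa$, $\mathrm{SAT}(\kappa)$ is the statement: there exists a nonprincipal ultrafilter $U$ over $\omega$ such that for every countable first-order language $L$ and every sequence $(\mathcal{A}_i)_{i\in\omega}$ of $L$-structures each of size $\le\kappa$, the ultraproduct $\prod_{i\in\omega}\mathcal{A}_i/U$ is saturated (i.e. $|M|$-saturated, $M$ the ultraproduct). $\mathfrak{c}=2^{\aleph_0}$ and $2^{<\mathfrak{c}}=\sup_{\kappa<\mathfrak{c}}2^\kappa$. *)

theory Defs
  imports Complex_Main "HOL-Library.Countable_Set" "HOL-Library.FuncSet"
begin

unbundle cardinal_syntax

text \<open>Constant symbols are function symbols of arity 0; equality is a logical symbol.\<close>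

record ('f, 'r) language =
  funs :: "'f set"
  rels :: "'r set"
  fun_arity :: "'f \<Rightarrow> nat"
  rel_arity :: "'r \<Rightarrow> nat"

definition countable_language :: "('f, 'r) language \<Rightarrow> bool" where
  "countable_language L \<longleftrightarrow> countable (funs L) \<and> countable (rels L)"

datatype 'f trm = Var nat | App 'f "'f trm list"

datatype ('f, 'r) fm =
    Equal "'f trm" "'f trm"
  | Rel 'r "'f trm list"
  | Neg "('f, 'r) fm"
  | Conj "('f, 'r) fm" "('f, 'r) fm"
  | Exi nat "('f, 'r) fm"

primrec wf_trm :: "('f, 'r) language \<Rightarrow> 'f trm \<Rightarrow> bool" where
  "wf_trm L (Var n) \<longleftrightarrow> True"
| "wf_trm L (App f ts) \<longleftrightarrow>
     f \<in> funs L \<and> length ts = fun_arity L f \<and> list_all (wf_trm L) ts"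

primrec wf_fm :: "('f, 'r) language \<Rightarrow> ('f, 'r) fm \<Rightarrow> bool" where
  "wf_fm L (Equal s t) \<longleftrightarrow> wf_trm L s \<and> wf_trm L t"
| "wf_fm L (Rel r ts) \<longleftrightarrow>
     r \<in> rels L \<and> length ts = rel_arity L r \<and> list_all (wf_trm L) ts"
| "wf_fm L (Neg \<phi>) \<longleftrightarrow> wf_fm L \<phi>"
| "wf_fm L (Conj \<phi> \<psi>) \<longleftrightarrow> wf_fm L \<phi> \<and> wf_fm L \<psi>"
| "wf_fm L (Exi n \<phi>) \<longleftrightarrow> wf_fm L \<phi>"

primrec fv_trm :: "'f trm \<Rightarrow> nat set" where
  "fv_trm (Var n) = {n}"
| "fv_trm (App f ts) = \<Union> (set (map fv_trm ts))"

primrec fv :: "('f, 'r) fm \<Rightarrow> nat set" where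
  "fv (Equal s t) = fv_trm s \<union> fv_trm t"
| "fv (Rel r ts) = \<Union> (set (map fv_trm ts))"
| "fv (Neg \<phi>) = fv \<phi>"
| "fv (Conj \<phi> \<psi>) = fv \<phi> \<union> fv \<psi>"
| "fv (Exi n \<phi>) = fv \<phi> - {n}"

record ('f, 'r, 'a) struct =
  univ :: "'a set"
  fun_int :: "'f \<Rightarrow> 'a list \<Rightarrow> 'a"
  rel_int :: "'r \<Rightarrow> 'a list \<Rightarrow> bool"

definition is_structure :: "('f, 'r) language \<Rightarrow> ('f, 'r, 'a) struct \<Rightarrow> bool" where
  "is_structure L M \<longleftrightarrow> univ M \<noteq> {} \<and>
     (\<forall>f\<in>funs L. \<forall>xs. set xs \<subseteq> univ M \<and> length xs = fun_arity L f \<longrightarrow> fun_int M f xs \<in> univ M)"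

primrec eval :: "('f, 'r, 'a) struct \<Rightarrow> (nat \<Rightarrow> 'a) \<Rightarrow> 'f trm \<Rightarrow> 'a" where
  "eval M e (Var n) = e n"
| "eval M e (App f ts) = fun_int M f (map (eval M e) ts)"

primrec sat :: "('f, 'r, 'a) struct \<Rightarrow> (nat \<Rightarrow> 'a) \<Rightarrow> ('f, 'r) fm \<Rightarrow> bool" where
  "sat M e (Equal s t) \<longleftrightarrow> eval M e s = eval M e t"
| "sat M e (Rel r ts) \<longleftrightarrow> rel_int M r (map (eval M e) ts)"
| "sat M e (Neg \<phi>) \<longleftrightarrow> \<not> sat M e \<phi>"
| "sat M e (Conj \<phi> \<psi>) \<longleftrightarrow> sat M e \<phi> \<and> sat M e \<psi>"
| "sat M e (Exi n \<phi>) \<longleftrightarrow> (\<exists>a\<in>univ M. sat M (e(n := a)) \<phi>)"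

text \<open>The language \<open>L\<^sub>A\<close>, with a new constant symbol \<open>Inr a\<close> for every \<open>a \<in> A\<close>, and the
  corresponding expansion of a structure.\<close>

definition add_constants :: "('f, 'r) language \<Rightarrow> 'a set \<Rightarrow> ('f + 'a, 'r) language" where
  "add_constants L A =
     \<lparr>funs = Inl ` funs L \<union> Inr ` A, rels = rels L,
      fun_arity = case_sum (fun_arity L) (\<lambda>_. 0), rel_arity = rel_arity L\<rparr>"

definition name_elements :: "('f, 'r, 'a) struct \<Rightarrow> ('f + 'a, 'r, 'a) struct" where
  "name_elements M =
     \<lparr>univ = univ M, fun_int = case_sum (fun_int M) (\<lambda>a _. a), rel_int = rel_int M\<rparr>"

text \<open>Only variable 0 may occur free in the formulas of a 1-type, so a constant assignment
  evaluates them at \<open>a\<close>.\<close>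

definition realizes :: "('f, 'r, 'a) struct \<Rightarrow> 'a \<Rightarrow> ('f + 'a, 'r) fm set \<Rightarrow> bool" where
  "realizes M a p \<longleftrightarrow> (\<forall>\<phi>\<in>p. sat (name_elements M) (\<lambda>_. a) \<phi>)"

definition one_type ::
  "('f, 'r) language \<Rightarrow> ('f, 'r, 'a) struct \<Rightarrow> 'a set \<Rightarrow> ('f + 'a, 'r) fm set \<Rightarrow> bool" where
  "one_type L M A p \<longleftrightarrow>
     (\<forall>\<phi>\<in>p. wf_fm (add_constants L A) \<phi> \<and> fv \<phi> \<subseteq> {0}) \<and>
     (\<forall>q. finite q \<and> q \<subseteq> p \<longrightarrow> (\<exists>a\<in>univ M. realizes M a q))"

definition card_saturated ::
  "'k rel \<Rightarrow> ('f, 'r) language \<Rightarrow> ('f, 'r, 'a) struct \<Rightarrow> bool" where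
  "card_saturated \<kappa> L M \<longleftrightarrow>
     (\<forall>A p. A \<subseteq> univ M \<and> |A| <o \<kappa> \<and> one_type L M A p \<longrightarrow> (\<exists>a\<in>univ M. realizes M a p))"

definition saturated :: "('f, 'r) language \<Rightarrow> ('f, 'r, 'a) struct \<Rightarrow> bool" where
  "saturated L M \<longleftrightarrow> card_saturated |univ M| L M"

definition ultrafilter :: "'i filter \<Rightarrow> bool" where
  "ultrafilter U \<longleftrightarrow> U \<noteq> bot \<and> (\<forall>P. eventually P U \<or> eventually (\<lambda>i. \<not> P i) U)"

definition nonprincipal_ultrafilter :: "'i filter \<Rightarrow> bool" where
  "nonprincipal_ultrafilter U \<longleftrightarrow> ultrafilter U \<and> (\<forall>i. U \<noteq> principal {i})"

definition ultra_eq ::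
  "'i filter \<Rightarrow> ('i \<Rightarrow> ('f, 'r, 'a) struct) \<Rightarrow> (('i \<Rightarrow> 'a) \<times> ('i \<Rightarrow> 'a)) set" where
  "ultra_eq U \<A> =
     {(x, y). x \<in> (\<Pi> i\<in>UNIV. univ (\<A> i)) \<and> y \<in> (\<Pi> i\<in>UNIV. univ (\<A> i)) \<and>
       (\<forall>\<^sub>F i in U. x i = y i)}"

definition repr :: "('i \<Rightarrow> 'a) set \<Rightarrow> 'i \<Rightarrow> 'a" where
  "repr X = (SOME x. x \<in> X)"

text \<open>Functions and relations are evaluated on chosen representatives; the choice does not
  matter, see \<open>ultraproduct_fun_int\<close> and \<open>ultraproduct_rel_int\<close> below.\<close>

definition ultraproduct ::
  "'i filter \<Rightarrow> ('i \<Rightarrow> ('f, 'r, 'a) struct) \<Rightarrow> ('f, 'r, ('i \<Rightarrow> 'a) set) struct" where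
  "ultraproduct U \<A> =
     \<lparr>univ = (\<Pi> i\<in>UNIV. univ (\<A> i)) // ultra_eq U \<A>,
      fun_int = (\<lambda>f Xs. ultra_eq U \<A> `` {\<lambda>i. fun_int (\<A> i) f (map (\<lambda>X. repr X i) Xs)}),
      rel_int = (\<lambda>r Xs. \<forall>\<^sub>F i in U. rel_int (\<A> i) r (map (\<lambda>X. repr X i) Xs))\<rparr>"

lemma equiv_ultra_eq: "equiv (\<Pi> i\<in>UNIV. univ (\<A> i)) (ultra_eq U \<A>)"
proof (rule equivI)
  show "ultra_eq U \<A> \<subseteq> (\<Pi> i\<in>UNIV. univ (\<A> i)) \<times> (\<Pi> i\<in>UNIV. univ (\<A> i))"
    by (auto simp: ultra_eq_def)
  show "refl_on (\<Pi> i\<in>UNIV. univ (\<A> i)) (ultra_eq U \<A>)"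
    by (auto simp: refl_on_def ultra_eq_def)
  show "sym (ultra_eq U \<A>)"
    by (auto simp: sym_def ultra_eq_def eq_commute)
  show "trans (ultra_eq U \<A>)"
  proof (rule transI)
    fix x y z assume a: "(x, y) \<in> ultra_eq U \<A>" "(y, z) \<in> ultra_eq U \<A>"
    then have "\<forall>\<^sub>F i in U. x i = y i" "\<forall>\<^sub>F i in U. y i = z i" by (auto simp: ultra_eq_def)
    then have "\<forall>\<^sub>F i in U. x i = z i" by eventually_elim simp
    with a show "(x, z) \<in> ultra_eq U \<A>" by (auto simp: ultra_eq_def)
  qed
qed

lemma repr_class:
  assumes "x \<in> (\<Pi> i\<in>UNIV. univ (\<A> i))"
  shows "(x, repr (ultra_eq U \<A> `` {x})) \<in> ultra_eq U \<A>"
proof -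
  have "x \<in> ultra_eq U \<A> `` {x}" using assms by (auto simp: ultra_eq_def)
  then have "repr (ultra_eq U \<A> `` {x}) \<in> ultra_eq U \<A> `` {x}"
    unfolding repr_def by (rule someI[where P = "\<lambda>y. y \<in> ultra_eq U \<A> `` {x}"])
  then show ?thesis by simp
qed

lemma eventually_repr_map:
  assumes "set xs \<subseteq> (\<Pi> i\<in>UNIV. univ (\<A> i))"
  shows "\<forall>\<^sub>F i in U. map (\<lambda>X. repr X i) (map (\<lambda>x. ultra_eq U \<A> `` {x}) xs) = map (\<lambda>x. x i) xs"
  using assms
proof (induction xs)
  case (Cons x xs)
  have "\<forall>\<^sub>F i in U. repr (ultra_eq U \<A> `` {x}) i = x i"
    using repr_class[of x \<A> U] Cons.prems by (auto simp: ultra_eq_def eq_commute)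
  moreover have "\<forall>\<^sub>F i in U. map (\<lambda>X. repr X i) (map (\<lambda>x. ultra_eq U \<A> `` {x}) xs) = map (\<lambda>x. x i) xs"
    using Cons by simp
  ultimately show ?case by eventually_elim simp
qed simp

lemma repr_in:
  assumes "X \<in> (\<Pi> i\<in>UNIV. univ (\<A> i)) // ultra_eq U \<A>"
  shows "repr X i \<in> univ (\<A> i)"
proof -
  obtain x where x: "x \<in> (\<Pi> i\<in>UNIV. univ (\<A> i))" "X = ultra_eq U \<A> `` {x}"
    using assms by (rule quotientE)
  then show ?thesis using repr_class[of x \<A> U] by (auto simp: ultra_eq_def)
qed

lemma ultraproduct_fun_int:
  assumes "\<And>i. is_structure L (\<A> i)" "f \<in> funs L" "length xs = fun_arity L f"
    and "set xs \<subseteq> (\<Pi> i\<in>UNIV. univ (\<A> i))"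
  shows "fun_int (ultraproduct U \<A>) f (map (\<lambda>x. ultra_eq U \<A> `` {x}) xs) =
    ultra_eq U \<A> `` {\<lambda>i. fun_int (\<A> i) f (map (\<lambda>x. x i) xs)}"
proof -
  let ?Xs = "map (\<lambda>x. ultra_eq U \<A> `` {x}) xs"
  have Xs: "X \<in> (\<Pi> i\<in>UNIV. univ (\<A> i)) // ultra_eq U \<A>" if "X \<in> set ?Xs" for X
    using that assms(4) by (auto intro: quotientI)
  have "(\<lambda>i. fun_int (\<A> i) f (map (\<lambda>X. repr X i) ?Xs)) \<in> (\<Pi> i\<in>UNIV. univ (\<A> i))"
  proof (rule Pi_I)
    fix i
    have "set (map (\<lambda>X. repr X i) ?Xs) \<subseteq> univ (\<A> i)" using repr_in[OF Xs] by fastforce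
    moreover have "length (map (\<lambda>X. repr X i) ?Xs) = fun_arity L f" using assms(3) by simp
    ultimately show "fun_int (\<A> i) f (map (\<lambda>X. repr X i) ?Xs) \<in> univ (\<A> i)"
      using assms(1)[of i] assms(2) unfolding is_structure_def by blast
  qed
  moreover have "(\<lambda>i. fun_int (\<A> i) f (map (\<lambda>x. x i) xs)) \<in> (\<Pi> i\<in>UNIV. univ (\<A> i))"
  proof (rule Pi_I)
    fix i
    have "set (map (\<lambda>x. x i) xs) \<subseteq> univ (\<A> i)" using assms(4) by fastforce
    moreover have "length (map (\<lambda>x. x i) xs) = fun_arity L f" using assms(3) by simp
    ultimately show "fun_int (\<A> i) f (map (\<lambda>x. x i) xs) \<in> univ (\<A> i)"
      using assms(1)[of i] assms(2) unfolding is_structure_def by blast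
  qed
  moreover have "\<forall>\<^sub>F i in U. fun_int (\<A> i) f (map (\<lambda>X. repr X i) ?Xs) = fun_int (\<A> i) f (map (\<lambda>x. x i) xs)"
    using eventually_repr_map[OF assms(4), of U] by (rule eventually_mono) (simp only:)
  ultimately have "(\<lambda>i. fun_int (\<A> i) f (map (\<lambda>X. repr X i) ?Xs),
      \<lambda>i. fun_int (\<A> i) f (map (\<lambda>x. x i) xs)) \<in> ultra_eq U \<A>"
    unfolding ultra_eq_def by blast
  then show ?thesis
    using equiv_class_eq[OF equiv_ultra_eq] by (simp add: ultraproduct_def)
qed

lemma ultraproduct_rel_int:
  assumes "set xs \<subseteq> (\<Pi> i\<in>UNIV. univ (\<A> i))"
  shows "rel_int (ultraproduct U \<A>) r (map (\<lambda>x. ultra_eq U \<A> `` {x}) xs) \<longleftrightarrow>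
    (\<forall>\<^sub>F i in U. rel_int (\<A> i) r (map (\<lambda>x. x i) xs))"
proof -
  have "\<forall>\<^sub>F i in U. rel_int (\<A> i) r (map (\<lambda>X. repr X i) (map (\<lambda>x. ultra_eq U \<A> `` {x}) xs)) =
    rel_int (\<A> i) r (map (\<lambda>x. x i) xs)"
    using eventually_repr_map[OF assms, of U] by (rule eventually_mono) (simp only:)
  then show ?thesis unfolding ultraproduct_def struct.simps by (rule eventually_subst)
qed

lemma is_structure_ultraproduct:
  assumes "\<And>i. is_structure L (\<A> i)"
  shows "is_structure L (ultraproduct U \<A>)"
  unfolding is_structure_def
proof (intro conjI ballI allI impI)
  have "(\<lambda>i. SOME a. a \<in> univ (\<A> i)) \<in> (\<Pi> i\<in>UNIV. univ (\<A> i))"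
    using assms by (auto simp: is_structure_def some_in_eq)
  then show "univ (ultraproduct U \<A>) \<noteq> {}"
    by (auto simp: ultraproduct_def quotient_def)
next
  fix f Xs
  assume f: "f \<in> funs L" and "set Xs \<subseteq> univ (ultraproduct U \<A>) \<and> length Xs = fun_arity L f"
  then have Xs: "\<And>X. X \<in> set Xs \<Longrightarrow> X \<in> (\<Pi> i\<in>UNIV. univ (\<A> i)) // ultra_eq U \<A>"
    and len: "length Xs = fun_arity L f" by (auto simp: ultraproduct_def)
  have "(\<lambda>i. fun_int (\<A> i) f (map (\<lambda>X. repr X i) Xs)) \<in> (\<Pi> i\<in>UNIV. univ (\<A> i))"
  proof (rule Pi_I)
    fix i
    have "set (map (\<lambda>X. repr X i) Xs) \<subseteq> univ (\<A> i)" using repr_in[OF Xs] by fastforce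
    moreover have "length (map (\<lambda>X. repr X i) Xs) = fun_arity L f" using len by simp
    ultimately show "fun_int (\<A> i) f (map (\<lambda>X. repr X i) Xs) \<in> univ (\<A> i)"
      using assms[of i] f unfolding is_structure_def by blast
  qed
  then show "fun_int (ultraproduct U \<A>) f Xs \<in> univ (ultraproduct U \<A>)"
    by (simp add: ultraproduct_def quotientI)
qed

text \<open>HOL cannot quantify over types inside a formula, so the symbols of the countable languages
  are natural numbers and the structures of size at most \<open>\<kappa>\<close> live on subsets of the type
  underlying \<open>\<kappa>\<close>. Up to renaming of symbols and isomorphism of structures, these are all
  countable languages and all structures of size at most \<open>\<kappa>\<close>.\<close>

definition SAT :: "'k rel \<Rightarrow> bool" where
  "SAT \<kappa> \<longleftrightarrow>
     (\<exists>U :: nat filter. nonprincipal_ultrafilter U \<and>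
       (\<forall>(L :: (nat, nat) language) (\<A> :: nat \<Rightarrow> (nat, nat, 'k) struct).
          countable_language L \<and> (\<forall>i. is_structure L (\<A> i) \<and> |univ (\<A> i)| \<le>o \<kappa>) \<longrightarrow>
          saturated L (ultraproduct U \<A>)))"

definition is_card_Sup :: "'a rel set \<Rightarrow> 'a rel \<Rightarrow> bool" where
  "is_card_Sup R s \<longleftrightarrow>
     Card_order s \<and> (\<forall>r\<in>R. r \<le>o s) \<and>
     (\<forall>t :: 'a rel. Card_order t \<and> (\<forall>r\<in>R. r \<le>o t) \<longrightarrow> s \<le>o t)"

text \<open>Cardinals are well-orders up to \<open>=o\<close>, so the choice of the supremum is
  immaterial. It exists and is unique by \<open>is_card_Sup_card_Sup\<close> and \<open>is_card_Sup_unique\<close>.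
  Upper bounds on the type \<open>'a\<close> suffice, since every smaller cardinal is represented there.\<close>

definition card_Sup :: "'a rel set \<Rightarrow> 'a rel" where
  "card_Sup R = (SOME s. is_card_Sup R s)"

lemma is_card_Sup_card_Sup:
  fixes R :: "'a rel set"
  assumes "\<And>r. r \<in> R \<Longrightarrow> Card_order r"
  shows "is_card_Sup R (card_Sup R)"
proof -
  let ?B = "{t :: 'a rel. Card_order t \<and> (\<forall>r\<in>R. r \<le>o t)}"
  have "r \<le>o |UNIV :: 'a set|" if "r \<in> R" for r
    by (rule ordIso_ordLeq_trans[OF ordIso_symmetric[OF card_of_Field_ordIso[OF assms[OF that]]]
          card_of_mono1[OF subset_UNIV]])
  then have "|UNIV :: 'a set| \<in> ?B" by (simp add: card_of_Card_order)
  then obtain s where "s \<in> ?B" "\<forall>t\<in>?B. s \<le>o t"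
    using exists_minim_Card_order[of ?B] by blast
  then have "is_card_Sup R s" unfolding is_card_Sup_def by blast
  then show ?thesis unfolding card_Sup_def by (rule someI)
qed

lemma is_card_Sup_unique: "is_card_Sup R s \<Longrightarrow> is_card_Sup R t \<Longrightarrow> s =o t"
  unfolding is_card_Sup_def ordIso_iff_ordLeq by blast

definition two_powers_below :: "'a rel \<Rightarrow> ('a \<Rightarrow> bool) rel" where
  "two_powers_below \<mu> = card_Sup {ctwo ^c \<kappa> |\<kappa> :: 'a rel. Card_order \<kappa> \<and> \<kappa> <o \<mu>}"

definition continuum :: "(nat \<Rightarrow> bool) rel" where
  "continuum = ctwo ^c natLeq"

end

theory Submission
  imports Defs "HOL-Library.Nat_Bijection"
begin

text \<open>Let \<open>M\<close> be the ultrapower of the natural numbers with the Ackermann membership relation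
  \<open>n \<in> set_decode m\<close>. It has size continuum. Any set \<open>B\<close> of elements of a parameter set \<open>A\<close> is
  described by the type saying that exactly the members of \<open>B\<close> among those of \<open>A\<close> belong to the
  unknown; it is finitely satisfiable, since every finite set of naturals has a code. Hence by
  saturation \<open>2\<^bsup>|A|\<^esup> \<le> |M|\<close> whenever \<open>|A| < |M|\<close>.\<close>

section \<open>Nonprincipal ultrafilters\<close>

text \<open>An ultrafilter that contains a singleton \<open>{k}\<close> is the principal one at
  \<open>k\<close>.\<close>

lemma eventually_neq_nonprincipal_ultrafilter:
  assumes "nonprincipal_ultrafilter U"
  shows "\<forall>\<^sub>F i in U. i \<noteq> k"
proof (rule ccontr)
  assume "\<not> ?thesis"
  moreover have "(\<forall>\<^sub>F i in U. i = k) \<or> (\<forall>\<^sub>F i in U. i \<noteq> k)"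
    using assms unfolding nonprincipal_ultrafilter_def ultrafilter_def by blast
  ultimately have k: "\<forall>\<^sub>F i in U. i = k" by blast
  have "principal {k} \<le> U"
  proof (rule filter_leI)
    fix P assume P: "eventually P U"
    \<comment> \<open>\<open>P k\<close> does not depend on \<open>i\<close>, so over a proper
      filter it holds eventually only if it is true.\<close>
    have "\<forall>\<^sub>F i in U. P k" using P k by eventually_elim simp
    moreover have "U \<noteq> bot"
      using assms by (auto simp: nonprincipal_ultrafilter_def ultrafilter_def)
    ultimately have "P k" by simp
    then show "eventually P (principal {k})" by (simp add: eventually_principal)
  qed
  moreover have "U \<le> principal {k}" using k by (simp add: le_principal)
  ultimately have "U = principal {k}" by (rule antisym[rotated])
  with assms show False by (simp add: nonprincipal_ultrafilter_def)
qed

lemma eventually_ge_nonprincipal_ultrafilter: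
  fixes U :: "nat filter"
  assumes "nonprincipal_ultrafilter U"
  shows "\<forall>\<^sub>F i in U. k \<le> i"
proof -
  have "\<forall>\<^sub>F i in U. \<forall>j\<in>{..<k}. i \<noteq> j"
    using eventually_neq_nonprincipal_ultrafilter[OF assms]
    by (intro eventually_ball_finite) auto
  then show ?thesis by eventually_elim (auto simp: not_less[symmetric])
qed

section \<open>The Ackermann ultrapower and its size\<close>

definition ackermann_language :: "(nat, nat) language" where
  "ackermann_language =
     \<lparr>funs = {}, rels = {0}, fun_arity = (\<lambda>_. 0), rel_arity = (\<lambda>_. 2)\<rparr>"

text \<open>A copy of the hereditarily finite sets: \<open>n\<close> is an element of
  \<open>m\<close> iff binary digit \<open>n\<close> of \<open>m\<close> is 1.\<close>

definition ackermann_struct :: "(nat, nat, nat) struct" where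
  "ackermann_struct =
     \<lparr>univ = UNIV, fun_int = (\<lambda>_ _. 0), rel_int = (\<lambda>_ xs. xs ! 0 \<in> set_decode (xs ! 1))\<rparr>"

abbreviation ackermann_power :: "nat filter \<Rightarrow> (nat, nat, (nat \<Rightarrow> nat) set) struct" where
  "ackermann_power U \<equiv> ultraproduct U (\<lambda>_. ackermann_struct)"

abbreviation power_class :: "nat filter \<Rightarrow> (nat \<Rightarrow> nat) \<Rightarrow> (nat \<Rightarrow> nat) set" where
  "power_class U x \<equiv> ultra_eq U (\<lambda>_. ackermann_struct) `` {x}"

lemma univ_ackermann_power: "univ (ackermann_power U) = range (power_class U)"
  by (auto simp: ultraproduct_def quotient_def ackermann_struct_def)

lemma power_class_eq_iff: "power_class U x = power_class U y \<longleftrightarrow> (\<forall>\<^sub>F i in U. x i = y i)"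
  using eq_equiv_class_iff[OF equiv_ultra_eq, of x "\<lambda>_. ackermann_struct" y U]
  by (auto simp: ultra_eq_def ackermann_struct_def)

lemma rel_int_ackermann_power:
  "rel_int (ackermann_power U) r [power_class U x, power_class U y] \<longleftrightarrow>
    (\<forall>\<^sub>F i in U. x i \<in> set_decode (y i))"
  using ultraproduct_rel_int[of "[x, y]" "\<lambda>_. ackermann_struct" U r]
  by (simp add: ackermann_struct_def)

text \<open>A function is determined by its graph, which pairing turns into a set of
  naturals.\<close>

lemma card_of_funs_nat_ordLeq: "|UNIV :: (nat \<Rightarrow> nat) set| \<le>o |UNIV :: (nat \<Rightarrow> bool) set|"
proof -
  let ?graph = "\<lambda>(f :: nat \<Rightarrow> nat) n. f (fst (prod_decode n)) = snd (prod_decode n)"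
  have "inj ?graph"
  proof (rule injI, rule ext)
    fix f g n assume "?graph f = ?graph g"
    from fun_cong[OF this, of "prod_encode (n, f n)"] show "f n = g n" by simp
  qed
  then show ?thesis by (intro card_of_ordLeq[THEN iffD1]) auto
qed

text \<open>Every class has a representative in \<open>nat \<Rightarrow> nat\<close>, which bounds
  the size from above. From below, a 0-1 sequence is sent to the class of the codes of its initial
  segments: distinct sequences have codes that differ from some point on, hence almost
  everywhere.\<close>

lemma card_of_ackermann_power:
  assumes "nonprincipal_ultrafilter U"
  shows "|univ (ackermann_power U)| =o |UNIV :: (nat \<Rightarrow> bool) set|"
proof -
  have "|univ (ackermann_power U)| \<le>o |UNIV :: (nat \<Rightarrow> nat) set|"
    unfolding univ_ackermann_power by (rule card_of_image)
  then have "|univ (ackermann_power U)| \<le>o |UNIV :: (nat \<Rightarrow> bool) set|"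
    using card_of_funs_nat_ordLeq by (rule ordLeq_transitive)
  moreover have "|UNIV :: (nat \<Rightarrow> bool) set| \<le>o |univ (ackermann_power U)|"
  proof -
    define code where "code f n = set_encode {k. k < n \<and> f k}" for f :: "nat \<Rightarrow> bool" and n
    have "inj (\<lambda>f. power_class U (code f))"
    proof (rule injI, rule ext)
      fix f g k assume "power_class U (code f) = power_class U (code g)"
      then have "\<forall>\<^sub>F i in U. code f i = code g i" by (simp only: power_class_eq_iff)
      \<comment> \<open>The value at \<open>k\<close> is recorded in \<open>code f i\<close> only
        when \<open>k < i\<close>.\<close>
      moreover have "\<forall>\<^sub>F i in U. Suc k \<le> i"
        using assms by (rule eventually_ge_nonprincipal_ultrafilter)
      ultimately have "\<forall>\<^sub>F i in U. code f i = code g i \<and> k < i"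
        by eventually_elim simp
      moreover have "U \<noteq> bot"
        using assms by (auto simp: nonprincipal_ultrafilter_def ultrafilter_def)
      ultimately obtain i where i: "code f i = code g i" "k < i"
        using eventually_happens' by blast
      then have "{k. k < i \<and> f k} = {k. k < i \<and> g k}"
        by (simp add: code_def set_encode_eq)
      with i(2) show "f k = g k" by blast
    qed
    then show ?thesis
      by (intro card_of_ordLeq[THEN iffD1]) (auto simp: univ_ackermann_power)
  qed
  ultimately show ?thesis by (simp add: ordIso_iff_ordLeq)
qed

section \<open>Saturation and sets of parameters\<close>

text \<open>This gives finite satisfiability of the type describing \<open>B\<close>. In each
  coordinate the finitely many values of representatives of \<open>F \<inter> B\<close> form a
  finite set, and its code is taken as the value of \<open>x\<close>.\<close>

lemma ex_ackermann_power_separating: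
  assumes U: "nonprincipal_ultrafilter U" and "finite F" and F: "F \<subseteq> univ (ackermann_power U)"
  shows "\<exists>x\<in>univ (ackermann_power U).
    \<forall>a\<in>F. rel_int (ackermann_power U) 0 [a, x] \<longleftrightarrow> a \<in> B"
proof -
  have "\<forall>a\<in>F. \<exists>x. power_class U x = a" using F by (auto simp: univ_ackermann_power)
  then obtain r where r: "\<And>a. a \<in> F \<Longrightarrow> power_class U (r a) = a" by metis
  define x where "x i = set_encode ((\<lambda>a. r a i) ` (F \<inter> B))" for i
  have x: "set_decode (x i) = (\<lambda>a. r a i) ` (F \<inter> B)" for i
    using \<open>finite F\<close> by (simp add: x_def)
  have "rel_int (ackermann_power U) 0 [a, power_class U x] \<longleftrightarrow> a \<in> B" if a: "a \<in> F" for a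
  proof -
    have rel: "rel_int (ackermann_power U) 0 [a, power_class U x] \<longleftrightarrow>
        (\<forall>\<^sub>F i in U. r a i \<in> (\<lambda>b. r b i) ` (F \<inter> B))"
      using rel_int_ackermann_power[of U 0 "r a" x] by (simp only: x r[OF a])
    show ?thesis
    proof (cases "a \<in> B")
      case True
      with a have "\<forall>\<^sub>F i in U. r a i \<in> (\<lambda>b. r b i) ` (F \<inter> B)" by (intro always_eventually) auto
      with True rel show ?thesis by blast
    next
      case False
      \<comment> \<open>In single coordinates \<open>r a i\<close> may coincide with some
        \<open>r b i\<close>, but for each \<open>b\<close> only on a set outside \<open>U\<close>;
        as \<open>F \<inter> B\<close> is finite, the union of these sets is outside
        \<open>U\<close> too.\<close>
      have "\<forall>\<^sub>F i in U. r a i \<noteq> r b i" if b: "b \<in> F \<inter> B" for b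
      proof -
        have "power_class U (r a) \<noteq> power_class U (r b)" using a b False r by auto
        then have "\<not> (\<forall>\<^sub>F i in U. r a i = r b i)" by (simp only: power_class_eq_iff not_False_eq_True)
        with U show ?thesis by (auto simp: nonprincipal_ultrafilter_def ultrafilter_def)
      qed
      then have "\<forall>\<^sub>F i in U. \<forall>b\<in>F \<inter> B. r a i \<noteq> r b i"
        using \<open>finite F\<close> by (intro eventually_ball_finite) auto
      then have "\<forall>\<^sub>F i in U. r a i \<notin> (\<lambda>b. r b i) ` (F \<inter> B)"
        by eventually_elim auto
      moreover have "\<not> (\<forall>\<^sub>F i in U. False)"
        using U by (auto simp: nonprincipal_ultrafilter_def ultrafilter_def)
      ultimately have "\<not> (\<forall>\<^sub>F i in U. r a i \<in> (\<lambda>b. r b i) ` (F \<inter> B))"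
        using eventually_elim2[of _ U _ "\<lambda>_. False"] by blast
      with False rel show ?thesis by blast
    qed
  qed
  then show ?thesis by (auto simp: univ_ackermann_power)
qed

text \<open>A realization of the type of \<open>B\<close> determines \<open>B\<close> within
  \<open>A\<close>, so choosing one for each subset of \<open>A\<close> is injective.\<close>

lemma card_of_Pow_ordLeq_saturated_ackermann_power:
  assumes U: "nonprincipal_ultrafilter U"
    and sat: "saturated ackermann_language (ackermann_power U)"
    and A: "A \<subseteq> univ (ackermann_power U)" and less: "|A| <o |univ (ackermann_power U)|"
  shows "|Pow A| \<le>o |univ (ackermann_power U)|"
proof -
  let ?M = "ackermann_power U"
  \<comment> \<open>\<open>mem a\<close> says that \<open>a\<close>, named by its constant
    \<open>Inr a\<close>, belongs to the unknown \<open>Var 0\<close>; \<open>lit B a\<close>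
    asserts or denies this according to \<open>B\<close>.\<close>
  define mem :: "(nat \<Rightarrow> nat) set \<Rightarrow> (nat + (nat \<Rightarrow> nat) set, nat) fm"
    where "mem a = Rel 0 [App (Inr a) [], Var 0]" for a
  define lit where "lit B a = (if a \<in> B then mem a else Neg (mem a))" for B a
  have "sat (name_elements ?M) (\<lambda>_. x) (lit B a) \<longleftrightarrow> (rel_int ?M 0 [a, x] \<longleftrightarrow> a \<in> B)" for x B a
    by (simp add: lit_def mem_def name_elements_def)
  then have sat_lit: "realizes ?M x (lit B ` F) \<longleftrightarrow> (\<forall>a\<in>F. rel_int ?M 0 [a, x] \<longleftrightarrow> a \<in> B)" for x B F
    by (simp only: realizes_def ball_simps)
  have "\<exists>x\<in>univ ?M. \<forall>a\<in>A. rel_int ?M 0 [a, x] \<longleftrightarrow> a \<in> B" for B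
  proof -
    have "one_type ackermann_language ?M A (lit B ` A)"
      unfolding one_type_def
    proof (intro conjI ballI allI impI)
      fix \<phi> assume "\<phi> \<in> lit B ` A"
      then show "wf_fm (add_constants ackermann_language A) \<phi>" "fv \<phi> \<subseteq> {0}"
        by (auto simp: lit_def mem_def add_constants_def ackermann_language_def)
    next
      fix q assume "finite q \<and> q \<subseteq> lit B ` A"
      \<comment> \<open>A finite part of the type mentions only finitely many parameters.\<close>
      then obtain F where "F \<subseteq> A" "finite F" "q = lit B ` F"
        by (metis finite_subset_image)
      then show "\<exists>x\<in>univ ?M. realizes ?M x q"
        using ex_ackermann_power_separating[OF U, of F B] A by (auto simp: sat_lit)
    qed
    then show ?thesis
      using sat A less unfolding saturated_def card_saturated_def sat_lit[symmetric] by blast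
  qed
  then obtain x where x: "\<And>B. x B \<in> univ ?M"
    "\<And>B a. a \<in> A \<Longrightarrow> rel_int ?M 0 [a, x B] \<longleftrightarrow> a \<in> B"
    by metis
  have "inj_on x (Pow A)"
  proof (rule inj_onI)
    fix B C assume "B \<in> Pow A" "C \<in> Pow A" "x B = x C"
    with x(2)[of _ B] x(2)[of _ C] show "B = C" by auto
  qed
  with x(1) show ?thesis by (intro card_of_ordLeq[THEN iffD1]) auto
qed

section \<open>Passage to cardinals and the supremum\<close>

lemma continuum_eq: "continuum = |UNIV :: (nat \<Rightarrow> bool) set|"
  by (simp add: continuum_def cexp_def Field_natLeq Field_card_of ctwo_def Func_def)

lemma ctwo_cexp_ordLeq_continuum:
  fixes \<kappa> :: "'a rel"
  assumes "SAT natLeq" "Card_order \<kappa>" "\<kappa> <o continuum"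
  shows "ctwo ^c \<kappa> \<le>o continuum"
proof -
  have struct: "is_structure ackermann_language ackermann_struct"
    "|univ ackermann_struct| \<le>o natLeq"
    by (auto simp: is_structure_def ackermann_language_def ackermann_struct_def
        intro: ordIso_imp_ordLeq card_of_nat)
  have "countable_language ackermann_language"
    by (simp add: countable_language_def ackermann_language_def)
  then have "countable_language ackermann_language \<and> (\<forall>i :: nat.
      is_structure ackermann_language ackermann_struct \<and> |univ ackermann_struct| \<le>o natLeq)"
    using struct by simp
  moreover obtain U where U: "nonprincipal_ultrafilter U"
    and U_sat: "\<And>L (\<A> :: nat \<Rightarrow> (nat, nat, nat) struct).
      countable_language L \<and> (\<forall>i. is_structure L (\<A> i) \<and> |univ (\<A> i)| \<le>o natLeq) \<Longrightarrow>
      saturated L (ultraproduct U \<A>)"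
    using assms(1) unfolding SAT_def by metis
  ultimately have sat: "saturated ackermann_language (ackermann_power U)" by (intro U_sat)
  let ?M = "univ (ackermann_power U)"
  have M: "|?M| =o continuum"
    unfolding continuum_eq by (rule card_of_ackermann_power[OF U])
  have Field: "|Field \<kappa>| =o \<kappa>" by (rule card_of_Field_ordIso[OF assms(2)])
  have less: "|Field \<kappa>| <o |?M|"
    using Field assms(3) M by (meson ordIso_ordLess_trans ordLess_ordIso_trans ordIso_symmetric)
  \<comment> \<open>Since \<open>\<kappa>\<close> is smaller than the ultrapower, a copy of its
    field there serves as the parameter set.\<close>
  then obtain g where g: "inj_on g (Field \<kappa>)" "g ` Field \<kappa> \<subseteq> ?M"
    using card_of_ordLeq[of "Field \<kappa>" ?M] ordLess_imp_ordLeq by blast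
  have bij: "|Field \<kappa>| =o |g ` Field \<kappa>|"
    using g(1) card_of_ordIso inj_on_imp_bij_betw by blast
  have "|g ` Field \<kappa>| <o |?M|"
    using bij less ordIso_ordLess_trans ordIso_symmetric by blast
  then have "|Pow (g ` Field \<kappa>)| \<le>o |?M|"
    using card_of_Pow_ordLeq_saturated_ackermann_power[OF U sat g(2)] by blast
  moreover have "ctwo ^c \<kappa> =o |Pow (Field \<kappa>)|"
    unfolding cexp_def ctwo_def Field_card_of
    by (rule ordIso_symmetric[OF card_of_Pow_Func])
  moreover have "|Pow (Field \<kappa>)| =o |Pow (g ` Field \<kappa>)|"
    using g(1) card_of_ordIso bij_betw_Pow inj_on_imp_bij_betw by blast
  ultimately show ?thesis
    using M by (meson ordIso_ordLeq_trans ordLeq_ordIso_trans)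
qed

text \<open>The supremum in \<open>two_powers_below\<close> is formed over fixed types; this moves a
  cardinal onto such a type, to serve as an exponent or as an upper bound.\<close>

lemma ex_Card_order_ordIso:
  fixes r :: "'b rel"
  assumes "Card_order r" "r \<le>o |UNIV :: 'a set|"
  shows "\<exists>s :: 'a rel. Card_order s \<and> s =o r"
proof -
  have Field: "|Field r| =o r" by (rule card_of_Field_ordIso[OF assms(1)])
  then have "|Field r| \<le>o |UNIV :: 'a set|" using assms(2) by (rule ordIso_ordLeq_trans)
  then obtain g :: "'b \<Rightarrow> 'a" where "inj_on g (Field r)"
    using card_of_ordLeq[of "Field r" "UNIV :: 'a set"] by blast
  then have "|Field r| =o |g ` Field r|"
    using card_of_ordIso inj_on_imp_bij_betw by blast
  then have "|g ` Field r| =o r"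
    using Field ordIso_symmetric ordIso_transitive by blast
  then show ?thesis using card_of_Card_order by blast
qed

theorem theorem3p5:
  assumes "SAT natLeq"
  shows "two_powers_below continuum =o continuum"
proof -
  let ?R = "{ctwo ^c \<kappa> |\<kappa> :: (nat \<Rightarrow> bool) rel. Card_order \<kappa> \<and> \<kappa> <o continuum}"
  have "is_card_Sup ?R (two_powers_below continuum)"
    unfolding two_powers_below_def
    by (rule is_card_Sup_card_Sup) (auto simp: Card_order_cexp)
  note Sup = this[unfolded is_card_Sup_def]
  note upper = bspec[OF conjunct1[OF conjunct2[OF Sup]]]
  note least = mp[OF spec[OF conjunct2[OF conjunct2[OF Sup]]], OF conjI]
  have natLeq: "natLeq <o continuum"
    unfolding continuum_def by (rule ordLess_ctwo_cexp[OF natLeq_Card_order])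
  have "continuum \<le>o two_powers_below continuum"
  proof -
    \<comment> \<open>The continuum is itself one of the powers, with exponent \<aleph>_0; the
      exponents live on \<open>nat \<Rightarrow> bool\<close>, so \<open>natLeq\<close> is replaced
      by a copy there.\<close>
    obtain \<kappa> :: "(nat \<Rightarrow> bool) rel" where \<kappa>: "Card_order \<kappa>" "\<kappa> =o natLeq"
      using ex_Card_order_ordIso[OF natLeq_Card_order] ordLess_imp_ordLeq[OF natLeq]
      unfolding continuum_eq by blast
    have "continuum =o ctwo ^c \<kappa>"
      unfolding continuum_def
      by (rule cexp_cong2[OF ordIso_symmetric[OF \<kappa>(2)] Card_order_ctwo natLeq_Card_order])
    moreover have "ctwo ^c \<kappa> \<in> ?R"
      using \<kappa> ordIso_ordLess_trans[OF \<kappa>(2) natLeq] by blast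
    ultimately show ?thesis by (rule ordIso_ordLeq_trans[OF _ upper])
  qed
  moreover have "two_powers_below continuum \<le>o continuum"
  proof -
    \<comment> \<open>The supremum is least only among bounds on its own type, so the continuum is
      copied there; the embedding sends a point to its singleton.\<close>
    have "|UNIV :: (nat \<Rightarrow> bool) set| \<le>o |UNIV :: ((nat \<Rightarrow> bool) \<Rightarrow> bool) set|"
      by (rule card_of_ordLeq[THEN iffD1]) (auto intro!: exI[of _ "\<lambda>x y. x = y"] injI dest: fun_cong)
    then obtain t :: "((nat \<Rightarrow> bool) \<Rightarrow> bool) rel" where t: "Card_order t" "t =o continuum"
      using ex_Card_order_ordIso[OF card_of_Card_order] unfolding continuum_eq by blast
    have "\<forall>r\<in>?R. r \<le>o t"
    proof
      fix r assume "r \<in> ?R"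
      then have "r \<le>o continuum" using ctwo_cexp_ordLeq_continuum[OF assms] by auto
      then show "r \<le>o t" by (rule ordLeq_ordIso_trans[OF _ ordIso_symmetric[OF t(2)]])
    qed
    then have "two_powers_below continuum \<le>o t" by (rule least[OF t(1)])
    then show ?thesis using t(2) by (rule ordLeq_ordIso_trans)
  qed
  ultimately show ?thesis by (simp add: ordIso_iff_ordLeq)
qed

end
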